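(* Let $X$ be a Tychonoff space and let $I$ be an ideal in $C(X)$. Then $C^*(X)\cap I$ is the path component, the component and the quasi-component of the zero function $\underline{0}$ in $C_{u^I}(X)$.
   Context: $C(X)$ is the ring of all real-valued continuous functions on $X$ (ideals may be improper), and $C^*(X)$ is the set of bounded functions in $C(X)$. The $u^I$-topology on $C(X)$ has as base the sets $B_u(f,I,\epsilon)=\{g\in C(X):\sup_{x\in X}|f(x)-g(x)|<\epsilon,\ f-g\in I\}$, $f\in C(X)$, $\epsilon>0$; $C_{u^I}(X)$ is $C(X)$ with this topology. The quasi-component of a point is the intersection of all clopen sets containing it. *)

theory Defs
  imports "HOL-Analysis.Analysis" "HOL-Algebra.Ideal"
begin

definition Tychonoff_space :: "'a topology \<Rightarrow> bool"
  where "Tychonoff_space X \<longleftrightarrow> completely_regular_space X \<and> Hausdorff_space X"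

text \<open>
  Continuous functions on \<open>X\<close> are represented by their extensional representatives, so that
  two of them are equal iff they agree on \<open>topspace X\<close>.
\<close>

definition C_ring :: "'a topology \<Rightarrow> ('a \<Rightarrow> real) ring"
  where "C_ring X =
    \<lparr>carrier = {f. continuous_map X euclideanreal f \<and> f \<in> extensional (topspace X)},
     mult = (\<lambda>f g. \<lambda>x\<in>topspace X. f x * g x),
     one = (\<lambda>x\<in>topspace X. 1),
     zero = (\<lambda>x\<in>topspace X. 0),
     add = (\<lambda>f g. \<lambda>x\<in>topspace X. f x + g x)\<rparr>"

definition C_star :: "'a topology \<Rightarrow> ('a \<Rightarrow> real) set"
  where "C_star X = {f \<in> carrier (C_ring X). bounded (f ` topspace X)}"

text \<open>
  The supremum is taken in the extended reals because \<open>f - g\<close> may be unbounded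
  (and \<open>X\<close> may be empty).
\<close>

definition B_u ::
  "'a topology \<Rightarrow> ('a \<Rightarrow> real) set \<Rightarrow> ('a \<Rightarrow> real) \<Rightarrow> real \<Rightarrow> ('a \<Rightarrow> real) set"
  where "B_u X I f \<epsilon> =
    {g \<in> carrier (C_ring X).
       (SUP x\<in>topspace X. ereal \<bar>f x - g x\<bar>) < ereal \<epsilon> \<and>
       (\<lambda>x\<in>topspace X. f x - g x) \<in> I}"

definition C_uI :: "'a topology \<Rightarrow> ('a \<Rightarrow> real) set \<Rightarrow> ('a \<Rightarrow> real) topology"
  where "C_uI X I = topology (arbitrary union_of
    (\<lambda>U. \<exists>f\<in>carrier (C_ring X). \<exists>\<epsilon>>0. U = B_u X I f \<epsilon>))"

lemma cring_C_ring: "cring (C_ring X)"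
proof (rule cringI)
  show "abelian_group (C_ring X)"
  proof (rule abelian_groupI)
    fix f assume f: "f \<in> carrier (C_ring X)"
    have "(\<lambda>x\<in>topspace X. - f x) \<in> carrier (C_ring X)"
      using f by (auto simp: C_ring_def intro!: continuous_map_eq[OF continuous_map_minus[of X f]])
    then show "\<exists>g\<in>carrier (C_ring X). g \<oplus>\<^bsub>C_ring X\<^esub> f = \<zero>\<^bsub>C_ring X\<^esub>"
      by (intro bexI) (auto simp: C_ring_def restrict_def)
  next
    fix f g assume "f \<in> carrier (C_ring X)" "g \<in> carrier (C_ring X)"
    then show "f \<oplus>\<^bsub>C_ring X\<^esub> g \<in> carrier (C_ring X)"
      by (auto simp: C_ring_def intro!: continuous_map_eq[OF continuous_map_add[of X f g]])
  next
    show "\<zero>\<^bsub>C_ring X\<^esub> \<in> carrier (C_ring X)"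
      by (auto simp: C_ring_def intro!: continuous_map_eq[of X _ "\<lambda>_. 0"])
  qed (auto simp: C_ring_def restrict_def extensional_def fun_eq_iff)
next
  show "comm_monoid (C_ring X)"
  proof (rule comm_monoidI)
    fix f g assume "f \<in> carrier (C_ring X)" "g \<in> carrier (C_ring X)"
    then show "f \<otimes>\<^bsub>C_ring X\<^esub> g \<in> carrier (C_ring X)"
      by (auto simp: C_ring_def intro!: continuous_map_eq[OF continuous_map_real_mult[of X f g]])
  next
    show "\<one>\<^bsub>C_ring X\<^esub> \<in> carrier (C_ring X)"
      by (auto simp: C_ring_def intro!: continuous_map_eq[of X _ "\<lambda>_. 1"])
  qed (auto simp: C_ring_def restrict_def extensional_def fun_eq_iff)
qed (auto simp: C_ring_def restrict_def fun_eq_iff distrib_right)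

lemma C_ring_minus:
  assumes "f \<in> carrier (C_ring X)" "g \<in> carrier (C_ring X)"
  shows "f \<ominus>\<^bsub>C_ring X\<^esub> g = (\<lambda>x\<in>topspace X. f x - g x)"
proof -
  interpret cring "C_ring X" by (rule cring_C_ring)
  have n: "(\<lambda>x\<in>topspace X. - g x) \<in> carrier (C_ring X)"
    using assms by (auto simp: C_ring_def intro!: continuous_map_eq[OF continuous_map_minus[of X g]])
  have "\<ominus>\<^bsub>C_ring X\<^esub> g = (\<lambda>x\<in>topspace X. - g x)"
    by (rule minus_equality[OF _ assms(2) n]) (auto simp: C_ring_def restrict_def)
  then show ?thesis
    by (auto simp: a_minus_def C_ring_def restrict_def)
qed

lemma B_u_shrink:
  assumes I: "ideal I (C_ring X)" and f: "f \<in> carrier (C_ring X)" and g: "g \<in> B_u X I f \<epsilon>"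
  shows "\<exists>\<delta>>0. B_u X I g \<delta> \<subseteq> B_u X I f \<epsilon>"
proof -
  interpret ideal I "C_ring X" by (rule I)
  let ?s = "SUP x\<in>topspace X. ereal \<bar>f x - g x\<bar>"
  have gc: "g \<in> carrier (C_ring X)" and s: "?s < ereal \<epsilon>"
    and fgI: "(\<lambda>x\<in>topspace X. f x - g x) \<in> I"
    using g by (auto simp: B_u_def)
  obtain r where r: "?s < ereal r" "ereal r < ereal \<epsilon>"
    using ereal_dense2[OF s] by blast
  have fg: "\<bar>f x - g x\<bar> \<le> r" if "x \<in> topspace X" for x
  proof -
    have "ereal \<bar>f x - g x\<bar> \<le> ?s" using that by (rule SUP_upper)
    then have "ereal \<bar>f x - g x\<bar> < ereal r" using r(1) by (rule le_less_trans)
    then show ?thesis by simp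
  qed
  have "B_u X I g ((\<epsilon> - r) / 2) \<subseteq> B_u X I f \<epsilon>"
  proof
    fix h assume h: "h \<in> B_u X I g ((\<epsilon> - r) / 2)"
    then have hc: "h \<in> carrier (C_ring X)"
      and lt: "(SUP x\<in>topspace X. ereal \<bar>g x - h x\<bar>) < ereal ((\<epsilon> - r) / 2)"
      and ghI: "(\<lambda>x\<in>topspace X. g x - h x) \<in> I"
      by (auto simp: B_u_def)
    have gh: "\<bar>g x - h x\<bar> \<le> (\<epsilon> - r) / 2" if "x \<in> topspace X" for x
    proof -
      have "ereal \<bar>g x - h x\<bar> \<le> (SUP x\<in>topspace X. ereal \<bar>g x - h x\<bar>)"
        using that by (rule SUP_upper)
      then have "ereal \<bar>g x - h x\<bar> < ereal ((\<epsilon> - r) / 2)" using lt by (rule le_less_trans)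
      then show ?thesis by simp
    qed
    have "(SUP x\<in>topspace X. ereal \<bar>f x - h x\<bar>) \<le> ereal (r + (\<epsilon> - r) / 2)"
    proof (rule SUP_least)
      fix x assume x: "x \<in> topspace X"
      have "\<bar>f x - h x\<bar> \<le> r + (\<epsilon> - r) / 2"
        using fg[OF x] gh[OF x] by linarith
      then show "ereal \<bar>f x - h x\<bar> \<le> ereal (r + (\<epsilon> - r) / 2)"
        by simp
    qed
    also have "\<dots> < ereal \<epsilon>" using r(2) by (simp add: field_simps)
    finally have sup: "(SUP x\<in>topspace X. ereal \<bar>f x - h x\<bar>) < ereal \<epsilon>" .
    have "(\<lambda>x\<in>topspace X. f x - g x) \<oplus>\<^bsub>C_ring X\<^esub> (\<lambda>x\<in>topspace X. g x - h x) \<in> I"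
      by (rule additive_subgroup.a_closed[OF is_additive_subgroup fgI ghI])
    moreover have "(\<lambda>x\<in>topspace X. f x - g x) \<oplus>\<^bsub>C_ring X\<^esub> (\<lambda>x\<in>topspace X. g x - h x)
        = (\<lambda>x\<in>topspace X. f x - h x)"
      by (auto simp: C_ring_def restrict_def)
    ultimately show "h \<in> B_u X I f \<epsilon>"
      using hc sup by (simp add: B_u_def)
  qed
  moreover have "(\<epsilon> - r) / 2 > 0" using r(2) by simp
  ultimately show ?thesis by blast
qed

lemma B_u_self:
  assumes "ideal I (C_ring X)" "f \<in> carrier (C_ring X)" "\<epsilon> > 0"
  shows "f \<in> B_u X I f \<epsilon>"
proof -
  interpret ideal I "C_ring X" by fact
  have "(SUP x\<in>topspace X. ereal \<bar>f x - f x\<bar>) \<le> ereal 0"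
    by (rule SUP_least) simp
  also have "\<dots> < ereal \<epsilon>" using assms by simp
  finally have "(SUP x\<in>topspace X. ereal \<bar>f x - f x\<bar>) < ereal \<epsilon>" .
  moreover have "(\<lambda>x\<in>topspace X. f x - f x) \<in> I"
    using additive_subgroup.zero_closed[OF is_additive_subgroup] by (simp add: C_ring_def)
  ultimately show ?thesis using assms by (simp add: B_u_def)
qed

lemma B_u_mono: "\<delta> \<le> \<epsilon> \<Longrightarrow> B_u X I f \<delta> \<subseteq> B_u X I f \<epsilon>"
  by (auto simp: B_u_def intro: less_le_trans)

text \<open>The sets \<open>B_u X I f \<epsilon>\<close> do form a base, so \<^const>\<open>C_uI\<close> is not a junk value.\<close>

lemma openin_C_uI:
  assumes I: "ideal I (C_ring X)"
  shows "openin (C_uI X I) =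
    arbitrary union_of (\<lambda>U. \<exists>f\<in>carrier (C_ring X). \<exists>\<epsilon>>0. U = B_u X I f \<epsilon>)"
proof -
  let ?P = "\<lambda>U. \<exists>f\<in>carrier (C_ring X). \<exists>\<epsilon>>0. U = B_u X I f \<epsilon>"
  have "(arbitrary union_of ?P) (S \<inter> T)" if ST: "?P S \<and> ?P T" for S T
  proof -
    have "\<exists>U. ?P U \<and> h \<in> U \<and> U \<subseteq> S \<inter> T" if h: "h \<in> S \<inter> T" for h
    proof -
      have hc: "h \<in> carrier (C_ring X)" using ST h by (auto simp: B_u_def)
      obtain d where d: "d > 0" "B_u X I h d \<subseteq> S" using ST h B_u_shrink[OF I] by blast
      obtain e where e: "e > 0" "B_u X I h e \<subseteq> T" using ST h B_u_shrink[OF I] by blast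
      have de: "min d e > 0" using d e by simp
      have "B_u X I h (min d e) \<subseteq> S \<inter> T"
        using d(2) e(2) B_u_mono[of "min d e" d X I h] B_u_mono[of "min d e" e X I h] by auto
      then show ?thesis using B_u_self[OF I hc de] hc de by blast
    qed
    then have "\<Union>{U. ?P U \<and> U \<subseteq> S \<inter> T} = S \<inter> T" by blast
    then show ?thesis
      unfolding union_of_def arbitrary_def by (intro exI[of _ "{U. ?P U \<and> U \<subseteq> S \<inter> T}"]) auto
  qed
  then have "istopology (arbitrary union_of ?P)" by (auto simp: istopology_base_eq)
  then show ?thesis by (simp add: C_uI_def)
qed

lemma topspace_C_uI:
  assumes I: "ideal I (C_ring X)"
  shows "topspace (C_uI X I) = carrier (C_ring X)"
proof
  show "topspace (C_uI X I) \<subseteq> carrier (C_ring X)"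
    using openin_topspace[of "C_uI X I"] unfolding openin_C_uI[OF I]
    by (auto simp: union_of_def B_u_def)
  show "carrier (C_ring X) \<subseteq> topspace (C_uI X I)"
  proof
    fix f assume f: "f \<in> carrier (C_ring X)"
    have "openin (C_uI X I) (B_u X I f 1)"
      unfolding openin_C_uI[OF I] using f
      by (intro union_of_inc) (auto simp: arbitrary_def intro!: exI[of _ "1::real"])
    then show "f \<in> topspace (C_uI X I)"
      using B_u_self[OF I f, of 1] openin_subset by fastforce
  qed
qed

end

theory Submission
  imports Defs
begin

text \<open>
  Since \<open>f - g \<in> I\<close> is bounded whenever \<open>g \<in> B_u X I f \<epsilon>\<close>, the set \<open>C_star X \<inter> I\<close> is a union
  of unit balls and so is its complement; being clopen, it contains the quasi-component of zero.
  Conversely, a bounded \<open>g \<in> I\<close> is joined to zero by the segment \<open>t \<mapsto> t g\<close>, which lies in \<open>I\<close>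
  because \<open>I\<close> absorbs constants, and which is Lipschitz for the sup norm because \<open>g\<close> is bounded.
\<close>

lemma B_uI:
  assumes "g \<in> carrier (C_ring X)" "(\<lambda>x\<in>topspace X. f x - g x) \<in> I"
    and "\<And>x. x \<in> topspace X \<Longrightarrow> \<bar>f x - g x\<bar> \<le> r" "r < \<epsilon>"
  shows "g \<in> B_u X I f \<epsilon>"
proof -
  \<comment> \<open>Strict pointwise bounds by \<open>\<epsilon>\<close> would bound the supremum
    only by \<open>\<le> \<epsilon>\<close>; the intermediate \<open>r\<close> keeps the inequality
    strict. On an empty space the supremum is minus infinity, so no case split arises.\<close>
  have "(SUP x\<in>topspace X. ereal \<bar>f x - g x\<bar>) \<le> ereal r"
    by (rule SUP_least) (simp add: assms(3))
  also have "\<dots> < ereal \<epsilon>"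
    using assms(4) by simp
  finally show ?thesis
    using assms(1,2) by (simp add: B_u_def)
qed

lemma B_uD:
  assumes "g \<in> B_u X I f \<epsilon>" "x \<in> topspace X"
  shows "\<bar>f x - g x\<bar> < \<epsilon>"
proof -
  have "ereal \<bar>f x - g x\<bar> \<le> (SUP x\<in>topspace X. ereal \<bar>f x - g x\<bar>)"
    using assms(2) by (rule SUP_upper)
  also have "\<dots> < ereal \<epsilon>"
    using assms(1) by (simp add: B_u_def)
  finally show ?thesis
    by simp
qed

lemma B_u_subset_carrier: "B_u X I f \<epsilon> \<subseteq> carrier (C_ring X)"
  by (auto simp: B_u_def)

text \<open>The base sets have arbitrary centres, but \<open>B_u_shrink\<close> recentres one at any
  of its points. Openness can therefore be tested as in a metric space.\<close>

lemma openin_C_uI_iff: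
  assumes I: "ideal I (C_ring X)"
  shows "openin (C_uI X I) U \<longleftrightarrow>
    U \<subseteq> carrier (C_ring X) \<and> (\<forall>f\<in>U. \<exists>\<epsilon>>0. B_u X I f \<epsilon> \<subseteq> U)"
proof
  assume U: "openin (C_uI X I) U"
  then have sub: "U \<subseteq> carrier (C_ring X)"
    using openin_subset topspace_C_uI[OF I] by blast
  moreover have "\<exists>\<epsilon>>0. B_u X I f \<epsilon> \<subseteq> U" if f: "f \<in> U" for f
  proof -
    obtain h \<epsilon> where "h \<in> carrier (C_ring X)" "f \<in> B_u X I h \<epsilon>" "B_u X I h \<epsilon> \<subseteq> U"
      using U f unfolding openin_C_uI[OF I] arbitrary_union_of_alt by blast
    then show ?thesis
      using B_u_shrink[OF I] by blast
  qed
  ultimately show "U \<subseteq> carrier (C_ring X) \<and> (\<forall>f\<in>U. \<exists>\<epsilon>>0. B_u X I f \<epsilon> \<subseteq> U)"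
    by blast
next
  assume U: "U \<subseteq> carrier (C_ring X) \<and> (\<forall>f\<in>U. \<exists>\<epsilon>>0. B_u X I f \<epsilon> \<subseteq> U)"
  show "openin (C_uI X I) U"
    unfolding openin_C_uI[OF I] arbitrary_union_of_alt
  proof
    fix f assume f: "f \<in> U"
    then obtain \<epsilon> where "\<epsilon> > 0" "B_u X I f \<epsilon> \<subseteq> U" "f \<in> carrier (C_ring X)"
      using U by blast
    then show "\<exists>V. (\<exists>f\<in>carrier (C_ring X). \<exists>\<epsilon>>0. V = B_u X I f \<epsilon>) \<and> f \<in> V \<and> V \<subseteq> U"
      using B_u_self[OF I] by blast
  qed
qed

text \<open>Two functions in a common ball differ by a bounded element of \<open>I\<close>, which
  changes neither boundedness nor membership in \<open>I\<close>. The equivalence serves twice: one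
  direction makes \<open>C_star X \<inter> I\<close> open, the other makes its complement
  open.\<close>

lemma B_u_C_star_Int_ideal_iff:
  assumes I: "ideal I (C_ring X)" and f: "f \<in> carrier (C_ring X)" and g: "g \<in> B_u X I f \<epsilon>"
  shows "g \<in> C_star X \<inter> I \<longleftrightarrow> f \<in> C_star X \<inter> I"
proof -
  interpret ideal I "C_ring X" by (rule I)
  let ?d = "\<lambda>x\<in>topspace X. f x - g x"
  have gc: "g \<in> carrier (C_ring X)" and d: "?d \<in> I"
    using g by (auto simp: B_u_def)
  \<comment> \<open>These are equalities of functions on the whole type: off
    \<open>topspace X\<close> both sides are \<open>undefined\<close>, because \<open>f\<close> and
    \<open>g\<close> are extensional. Closure of \<open>I\<close> under sums and negatives then
    gives both directions.\<close>
  have "f = ?d \<oplus>\<^bsub>C_ring X\<^esub> g"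
    using f by (auto simp: C_ring_def fun_eq_iff extensional_def)
  moreover have "g = f \<ominus>\<^bsub>C_ring X\<^esub> ?d"
    using gc C_ring_minus[OF f Icarr[OF d]]
    by (auto simp: C_ring_def fun_eq_iff extensional_def)
  ultimately have ideal: "g \<in> I \<longleftrightarrow> f \<in> I"
    using additive_subgroup.a_closed[OF is_additive_subgroup d, of g]
      additive_subgroup.a_closed[OF is_additive_subgroup _
        additive_subgroup.a_inv_closed[OF is_additive_subgroup d], of f]
    unfolding a_minus_def by argo
  have close: "\<bar>f x - g x\<bar> < \<epsilon>" if "x \<in> topspace X" for x
    using B_uD[OF g that] .
  have "bounded (g ` topspace X) \<longleftrightarrow> bounded (f ` topspace X)"
  proof
    assume "bounded (g ` topspace X)"
    then obtain B where B: "\<And>x. x \<in> topspace X \<Longrightarrow> \<bar>g x\<bar> \<le> B"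
      by (auto simp: bounded_iff)
    have "\<bar>f x\<bar> \<le> B + \<epsilon>" if "x \<in> topspace X" for x
      using B[OF that] close[OF that] by linarith
    then show "bounded (f ` topspace X)"
      by (auto simp: bounded_iff)
  next
    assume "bounded (f ` topspace X)"
    then obtain B where B: "\<And>x. x \<in> topspace X \<Longrightarrow> \<bar>f x\<bar> \<le> B"
      by (auto simp: bounded_iff)
    have "\<bar>g x\<bar> \<le> B + \<epsilon>" if "x \<in> topspace X" for x
      using B[OF that] close[OF that] by linarith
    then show "bounded (g ` topspace X)"
      by (auto simp: bounded_iff)
  qed
  with ideal f gc show ?thesis
    by (simp add: C_star_def)
qed

lemma clopen_C_star_Int_ideal:
  assumes I: "ideal I (C_ring X)"
  shows "openin (C_uI X I) (C_star X \<inter> I)" "closedin (C_uI X I) (C_star X \<inter> I)"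
proof -
  have sub: "C_star X \<inter> I \<subseteq> carrier (C_ring X)"
    by (auto simp: C_star_def)
  show "openin (C_uI X I) (C_star X \<inter> I)"
    unfolding openin_C_uI_iff[OF I]
    using sub B_u_C_star_Int_ideal_iff[OF I, where \<epsilon> = 1] zero_less_one by blast
  have "openin (C_uI X I) (carrier (C_ring X) - C_star X \<inter> I)"
    unfolding openin_C_uI_iff[OF I]
  proof (intro conjI ballI)
    fix f assume f: "f \<in> carrier (C_ring X) - C_star X \<inter> I"
    \<comment> \<open>The radius 1 is arbitrary, since the equivalence holds for every
      radius.\<close>
    have "B_u X I f 1 \<subseteq> carrier (C_ring X) - C_star X \<inter> I"
      using f B_u_C_star_Int_ideal_iff[OF I] B_u_subset_carrier by blast
    then show "\<exists>\<epsilon>>0. B_u X I f \<epsilon> \<subseteq> carrier (C_ring X) - C_star X \<inter> I"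
      using zero_less_one by blast
  qed blast
  then show "closedin (C_uI X I) (C_star X \<inter> I)"
    using sub by (simp add: closedin_def topspace_C_uI[OF I])
qed

text \<open>A ring ideal is not by definition a linear subspace, but scaling by \<open>c\<close> is
  multiplication by a constant function, which is continuous.\<close>

lemma ideal_C_ring_scale:
  assumes I: "ideal I (C_ring X)" and g: "g \<in> I"
  shows "(\<lambda>x\<in>topspace X. c * g x) \<in> I"
proof -
  interpret ideal I "C_ring X" by (rule I)
  have "(\<lambda>x\<in>topspace X. c) \<in> carrier (C_ring X)"
    by (auto simp: C_ring_def intro!: continuous_map_eq[of X _ "\<lambda>_. c"])
  moreover have "(\<lambda>x\<in>topspace X. c) \<otimes>\<^bsub>C_ring X\<^esub> g = (\<lambda>x\<in>topspace X. c * g x)"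
    by (auto simp: C_ring_def restrict_def)
  ultimately show ?thesis
    using I_l_closed[OF g] by metis
qed

lemma pathin_scale:
  assumes I: "ideal I (C_ring X)" and g: "g \<in> C_star X \<inter> I"
  shows "pathin (C_uI X I) (\<lambda>t. \<lambda>x\<in>topspace X. t * g x)"
proof -
  interpret ideal I "C_ring X" by (rule I)
  let ?p = "\<lambda>t. \<lambda>x\<in>topspace X. t * g x"
  have pI: "?p t \<in> I" for t
    using ideal_C_ring_scale[OF I] g by blast
  then have pc: "?p t \<in> carrier (C_ring X)" for t
    by (rule Icarr)
  have "bounded (g ` topspace X)"
    using g by (simp add: C_star_def)
  \<comment> \<open>A strictly positive bound allows division by \<open>M\<close> below, even when
    \<open>g\<close> vanishes or \<open>X\<close> is empty.\<close>
  then obtain M where M: "M > 0" "\<And>x. x \<in> topspace X \<Longrightarrow> \<bar>g x\<bar> \<le> M"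
    unfolding bounded_pos by auto
  have near: "?p t \<in> B_u X I (?p s) \<epsilon>" if "\<bar>s - t\<bar> * M < \<epsilon>" for s t \<epsilon>
  proof (rule B_uI[OF pc])
    \<comment> \<open>The difference of two points of the segment is again a multiple of
      \<open>g\<close>, hence in \<open>I\<close>.\<close>
    have "(\<lambda>x\<in>topspace X. ?p s x - ?p t x) = ?p (s - t)"
      by (auto simp: fun_eq_iff left_diff_distrib)
    then show "(\<lambda>x\<in>topspace X. ?p s x - ?p t x) \<in> I"
      using pI by metis
    show "\<bar>?p s x - ?p t x\<bar> \<le> \<bar>s - t\<bar> * M" if "x \<in> topspace X" for x
      using that mult_left_mono[OF M(2)[OF that], of "\<bar>s - t\<bar>"]
      by (simp add: left_diff_distrib[symmetric] abs_mult)
  qed (fact that)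
  have "openin (top_of_set {0..1}) {t \<in> {0..1}. ?p t \<in> U}"
    if U: "openin (C_uI X I) U" for U
    unfolding openin_contains_ball
  proof (intro conjI ballI)
    fix s assume "s \<in> {t \<in> {0..1}. ?p t \<in> U}"
    then obtain \<epsilon> where \<epsilon>: "\<epsilon> > 0" "B_u X I (?p s) \<epsilon> \<subseteq> U"
      using U unfolding openin_C_uI_iff[OF I] by blast
    have "ball s (\<epsilon> / M) \<inter> {0..1} \<subseteq> {t \<in> {0..1}. ?p t \<in> U}"
      using near \<epsilon>(2) M(1) by (auto simp: dist_real_def pos_less_divide_eq)
    then show "\<exists>e>0. ball s e \<inter> {0..1} \<subseteq> {t \<in> {0..1}. ?p t \<in> U}"
      using \<epsilon>(1) M(1) by (intro exI[of _ "\<epsilon> / M"]) simp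
  qed auto
  then show ?thesis
    using pc by (simp add: pathin_def continuous_map_def topspace_C_uI[OF I])
qed

theorem theorem7p2:
  fixes X :: "'a topology" and I :: "('a \<Rightarrow> real) set"
  assumes "Tychonoff_space X"
    and "ideal I (C_ring X)"
  shows "path_component_of_set (C_uI X I) \<zero>\<^bsub>C_ring X\<^esub> = C_star X \<inter> I \<and>
    connected_component_of_set (C_uI X I) \<zero>\<^bsub>C_ring X\<^esub> = C_star X \<inter> I \<and>
    quasi_component_of_set (C_uI X I) \<zero>\<^bsub>C_ring X\<^esub> = C_star X \<inter> I"
proof -
  interpret ideal I "C_ring X" by (rule assms(2))
  let ?Z = "\<zero>\<^bsub>C_ring X\<^esub>" and ?T = "C_uI X I"
  have Z: "?Z = (\<lambda>x\<in>topspace X. 0)"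
    by (simp add: C_ring_def)
  have "bounded (?Z ` topspace X)"
    unfolding Z by (rule bounded_subset[of "{0}"]) auto
  then have "?Z \<in> C_star X \<inter> I"
    by (simp add: C_star_def)
  then have quasi: "quasi_component_of_set ?T ?Z \<subseteq> C_star X \<inter> I"
    using clopen_C_star_Int_ideal[OF assms(2)] unfolding quasi_component_of_def by blast
  have path: "C_star X \<inter> I \<subseteq> path_component_of_set ?T ?Z"
  proof
    fix g assume g: "g \<in> C_star X \<inter> I"
    then have "(\<lambda>x\<in>topspace X. 1 * g x) = g"
      by (auto simp: C_star_def C_ring_def fun_eq_iff extensional_def)
    moreover have "(\<lambda>x\<in>topspace X. 0 * g x) = ?Z"
      by (simp add: Z)
    ultimately show "g \<in> path_component_of_set ?T ?Z"
      using pathin_scale[OF assms(2) g] unfolding path_component_of_def by blast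
  qed
  \<comment> \<open>These two general inclusions close a cycle with \<open>quasi\<close> and
    \<open>path\<close>, so all four sets coincide.\<close>
  have "path_component_of_set ?T ?Z \<subseteq> connected_component_of_set ?T ?Z"
    by (rule path_component_subset_connected_component_of)
  moreover have "connected_component_of_set ?T ?Z \<subseteq> quasi_component_of_set ?T ?Z"
    by (rule connected_component_subset_quasi_component_of)
  ultimately show ?thesis
    using quasi path by blast
qed

end
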